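(* Let $N\ge1$ and $G>0$. At every state $U\in\mathcal A_N$ satisfying $$\alpha_1=\cdots=\alpha_N=0,\qquad(\beta_1,\ldots,\beta_N)\neq0,$$ the eigenvalue $u_m$ of the $x$-direction coefficient matrix $A_L(U)$ of the two-dimensional SWLME has algebraic multiplicity $2N+1$ and geometric multiplicity $2N$. Therefore, the (direct) two-dimensional SWLME is not globally hyperbolic on $\mathcal A_N$.
   Context: State space: $\mathcal A_N=\{U\in\mathbb R^{2N+3}: h>0\}$, where $$U=(h,hu_m,hv_m,h\alpha_1,h\beta_1,\ldots,h\alpha_N,h\beta_N)^T,$$ so that $u_m,v_m,\alpha_j,\beta_j$ are the functions of $U$ obtained by dividing the corresponding component by $h$. The two-dimensional shallow water linearized moment equations (SWLME) are $\partial_tU+A_L(U)\partial_xU+B_L(U)\partial_yU=S(U)$ (the source $S$ plays no role here), with $A_L(U)=\partial_UF_L(U)+P_1(U)$, $B_L(U)=\partial_UG_L(U)+Q_1(U)$ ($\partial_U$ is the Jacobian with respect to the components of $U$), where $$F_L(U)=\Big(hu_m,\;h\big(u_m^2+\sum_{j=1}^N\tfrac{\alpha_j^2}{2j+1}\big)+\tfrac12Gh^2,\;h\big(u_mv_m+\sum_{j=1}^N\tfrac{\alpha_j\beta_j}{2j+1}\big),\;2hu_m\alpha_1,\;h(u_m\beta_1+v_m\alpha_1),\ldots,2hu_m\alpha_N,\;h(u_m\beta_N+v_m\alpha_N)\Big)^T,$$ $$G_L(U)=\Big(hv_m,\;h\big(u_mv_m+\sum_{j=1}^N\tfrac{\alpha_j\beta_j}{2j+1}\big),\;h\big(v_m^2+\sum_{j=1}^N\tfrac{\beta_j^2}{2j+1}\big)+\tfrac12Gh^2,\;h(u_m\beta_1+v_m\alpha_1),\;2hv_m\beta_1,\ldots,h(u_m\beta_N+v_m\alpha_N),\;2hv_m\beta_N\Big)^T,$$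 and $P_1(U)=\mathrm{diag}(0_{3\times3},p(U),\ldots,p(U))$, $Q_1(U)=\mathrm{diag}(0_{3\times3},q(U),\ldots,q(U))$ (block diagonal, $N$ copies of the $2\times2$ block) with $$p(U)=\begin{pmatrix}-u_m&0\\-v_m&0\end{pmatrix},\qquad q(U)=\begin{pmatrix}0&-u_m\\0&-v_m\end{pmatrix}.$$ Global hyperbolicity: a system with coefficient matrices $A(U),B(U)$ is globally hyperbolic on $\mathcal A_N$ if for every $U\in\mathcal A_N$ and every unit vector $n=(\cos\theta,\sin\theta)^T$ the matrix $\cos\theta\,A(U)+\sin\theta\,B(U)$ is diagonalizable over $\mathbb R$. *)

theory Defs
  imports
    "HOL-Analysis.Derivative"
    "Jordan_Normal_Form.Char_Poly"
    "Jordan_Normal_Form.Matrix_Kernel"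
begin

text \<open>A state is a vector of dimension \<open>2 * N + 3\<close>, with zero-based components
  \<open>h, h * u_m, h * v_m, h * alpha_1, h * beta_1, ..., h * alpha_N, h * beta_N\<close>.
  Thus \<open>h * alpha_j\<close> and \<open>h * beta_j\<close> (for \<open>1 \<le> j \<le> N\<close>) have the
  indices \<open>2 * j + 1\<close> and \<open>2 * j + 2\<close>.\<close>

definition water_height :: "real vec \<Rightarrow> real" where
  "water_height U = U $ 0"

definition state_space :: "nat \<Rightarrow> real vec set" where
  "state_space N = {U \<in> carrier_vec (2 * N + 3). water_height U > 0}"

definition um :: "real vec \<Rightarrow> real" where
  "um U = U $ 1 / water_height U"

definition vm :: "real vec \<Rightarrow> real" where
  "vm U = U $ 2 / water_height U"

definition alpha :: "nat \<Rightarrow> real vec \<Rightarrow> real" where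
  "alpha j U = U $ (2 * j + 1) / water_height U"

definition beta :: "nat \<Rightarrow> real vec \<Rightarrow> real" where
  "beta j U = U $ (2 * j + 2) / water_height U"

text \<open>In the moment components (\<open>i \<ge> 3\<close>) of the fluxes the moment number is
  \<open>j = (i - 1) div 2\<close>; the \<open>alpha_j\<close>-equation has odd \<open>i\<close>, the
  \<open>beta_j\<close>-equation even \<open>i\<close>.\<close>

definition flux_x :: "nat \<Rightarrow> real \<Rightarrow> real vec \<Rightarrow> real vec" where
  "flux_x N G U = (let h = water_height U; u = um U; v = vm U in
     vec (2 * N + 3) (\<lambda>i.
       if i = 0 then h * u
       else if i = 1 then
         h * (u\<^sup>2 + (\<Sum>j = 1..N. (alpha j U)\<^sup>2 / real (2 * j + 1))) + 1 / 2 * G * h\<^sup>2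
       else if i = 2 then
         h * (u * v + (\<Sum>j = 1..N. alpha j U * beta j U / real (2 * j + 1)))
       else let j = (i - 1) div 2 in
         if odd i then 2 * h * u * alpha j U
         else h * (u * beta j U + v * alpha j U)))"

definition flux_y :: "nat \<Rightarrow> real \<Rightarrow> real vec \<Rightarrow> real vec" where
  "flux_y N G U = (let h = water_height U; u = um U; v = vm U in
     vec (2 * N + 3) (\<lambda>i.
       if i = 0 then h * v
       else if i = 1 then
         h * (u * v + (\<Sum>j = 1..N. alpha j U * beta j U / real (2 * j + 1)))
       else if i = 2 then
         h * (v\<^sup>2 + (\<Sum>j = 1..N. (beta j U)\<^sup>2 / real (2 * j + 1))) + 1 / 2 * G * h\<^sup>2
       else let j = (i - 1) div 2 in
         if odd i then h * (u * beta j U + v * alpha j U)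
         else 2 * h * v * beta j U))"

text \<open>Entry \<open>(i, j)\<close> is the partial derivative of the \<open>i\<close>-th component of
  \<open>F\<close> with respect to the \<open>j\<close>-th component of the state. The fluxes used here
  are rational in the state with powers of \<open>h\<close> as only denominators, so all these
  derivatives exist where \<open>h > 0\<close>.\<close>

definition jacobian :: "nat \<Rightarrow> (real vec \<Rightarrow> real vec) \<Rightarrow> real vec \<Rightarrow> real mat" where
  "jacobian n F U = mat n n (\<lambda>(i, j). deriv (\<lambda>t. F (update_vec U j t) $ i) (U $ j))"

definition nonconservative_x :: "nat \<Rightarrow> real vec \<Rightarrow> real mat" where
  "nonconservative_x N U = diag_block_mat
     (0\<^sub>m 3 3 # replicate N (mat_of_rows_list 2 [[- um U, 0], [- vm U, 0]]))"

definition nonconservative_y :: "nat \<Rightarrow> real vec \<Rightarrow> real mat" where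
  "nonconservative_y N U = diag_block_mat
     (0\<^sub>m 3 3 # replicate N (mat_of_rows_list 2 [[0, - um U], [0, - vm U]]))"

definition swlme_A :: "nat \<Rightarrow> real \<Rightarrow> real vec \<Rightarrow> real mat" where
  "swlme_A N G U = jacobian (2 * N + 3) (flux_x N G) U + nonconservative_x N U"

definition swlme_B :: "nat \<Rightarrow> real \<Rightarrow> real vec \<Rightarrow> real mat" where
  "swlme_B N G U = jacobian (2 * N + 3) (flux_y N G) U + nonconservative_y N U"

text \<open>Since the scalars are real, similarity below is similarity over the reals.\<close>

definition real_diagonalizable :: "real mat \<Rightarrow> bool" where
  "real_diagonalizable M \<longleftrightarrow> (\<exists>D. diagonal_mat D \<and> similar_mat M D)"

definition globally_hyperbolic ::
  "nat \<Rightarrow> (real vec \<Rightarrow> real mat) \<Rightarrow> (real vec \<Rightarrow> real mat) \<Rightarrow> bool" where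
  "globally_hyperbolic N A B \<longleftrightarrow>
     (\<forall>U \<in> state_space N. \<forall>\<theta> :: real.
        real_diagonalizable (cos \<theta> \<cdot>\<^sub>m A U + sin \<theta> \<cdot>\<^sub>m B U))"

definition alg_mult :: "real mat \<Rightarrow> real \<Rightarrow> nat" where
  "alg_mult M ev = Polynomial.order ev (char_poly M)"

text \<open>\<open>char_matrix M ev\<close> is \<open>M\<close> minus \<open>ev\<close> times the identity,
  so its kernel is the eigenspace.\<close>

definition geom_mult :: "real mat \<Rightarrow> real \<Rightarrow> nat" where
  "geom_mult M ev = kernel_dim (char_matrix M ev)"

end

theory Submission
  imports Defs "Jordan_Normal_Form.Jordan_Normal_Form_Uniqueness"
begin

text \<open>Where all \<open>alpha_j\<close> vanish, the only nonzero entries of \<open>A_L - u_m I\<close> outside the first two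
  columns are \<open>beta_j / (2 j + 1)\<close>, in the \<open>h v_m\<close>-row and the \<open>alpha_j\<close>-columns. The matrix
  is therefore block lower triangular. Its leading \<open>2 \<times> 2\<close> block has characteristic polynomial \<open>(X - u_m)^2 - G h\<close>, which does not vanish at \<open>u_m\<close>,
  and the remaining block is triangular with constant diagonal \<open>u_m\<close>. The eigenspace is cut out
  by the independent equations \<open>x_0 = 0\<close>, \<open>x_1 = 0\<close> and \<open>\<Sum>j. beta_j / (2 j + 1) * x_(2 j + 1) = 0\<close>, the
  last of which is nontrivial because some \<open>beta_j\<close> is nonzero. A real diagonalizable matrix has
  equal multiplicities, so hyperbolicity fails at any such state, with \<open>\<theta> = 0\<close>.\<close>

unbundle no vec_syntax

section \<open>Kernel dimensions and multiplicities of diagonalizable matrices\<close>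

text \<open>The indices in \<open>I\<close> play the role of the free variables of the system \<open>A v = 0\<close>.\<close>

lemma kernel_dim_eq_card:
  fixes A :: "'a :: field mat"
  assumes A: "A \<in> carrier_mat nr nc" and I: "I \<subseteq> {..<nc}"
    and ker: "\<And>i. i \<in> I \<Longrightarrow> b i \<in> mat_kernel A"
    and delta: "\<And>i j. i \<in> I \<Longrightarrow> j \<in> I \<Longrightarrow> b i $ j = (if i = j then 1 else 0)"
    and zero: "\<And>v. v \<in> mat_kernel A \<Longrightarrow> (\<And>i. i \<in> I \<Longrightarrow> v $ i = 0) \<Longrightarrow> v = 0\<^sub>v nc"
  shows "kernel_dim A = card I"
proof -
  interpret kernel nr nc A by unfold_locales (rule A)
  have fin: "finite I" using I finite_subset by blast
  have inj: "inj_on b I"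
    by (rule inj_onI) (metis delta zero_neq_one)
  let ?B = "b ` I"
  have sub: "?B \<subseteq> mat_kernel A" using ker by auto
  have finB: "finite ?B" using fin by simp
  \<comment> \<open>The coordinates in \<open>I\<close> of a combination are its coefficients; this
    gives independence directly and serves again for spanning.\<close>
  have lincomb_nth: "lincomb a ?B $ j = a (b j)" if "j \<in> I" for a j
  proof -
    have "j < nc" using that I by auto
    then have "lincomb a ?B $ j = (\<Sum>i\<in>I. a (b i) * b i $ j)"
      by (simp add: lincomb_index[OF _ sub] sum.reindex[OF inj])
    also have "\<dots> = (\<Sum>i\<in>I. if i = j then a (b j) else 0)"
      by (rule sum.cong) (auto simp: delta that)
    finally show ?thesis using fin that by simp
  qed
  have "basis ?B"
    unfolding Ker.basis_def
  proof (intro conjI)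
    show "?B \<subseteq> mat_kernel A" by (rule sub)
    show "lin_indpt ?B"
    proof (rule Ker.finite_lin_indpt2[OF finB sub])
      fix a assume lc: "lincomb a ?B = 0\<^sub>v nc"
      have "a (b j) = 0" if "j \<in> I" for j
        using lincomb_nth[OF that, of a] lc that I by auto
      then show "\<forall>v\<in>?B. a v = 0" by auto
    qed
    show "span ?B = mat_kernel A"
    proof
      show "span ?B \<subseteq> mat_kernel A" using sub by (rule Ker.span_is_subset2)
      show "mat_kernel A \<subseteq> span ?B"
      proof
        fix v assume v: "v \<in> mat_kernel A"
        \<comment> \<open>The coefficients are the coordinates of \<open>v\<close> in
          \<open>I\<close>. Hence \<open>v - w\<close> is a kernel vector that vanishes on
          \<open>I\<close>, and \<open>zero\<close> forces \<open>v = w\<close>.\<close>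
        define a where "a = (\<lambda>w. v $ the_inv_into I b w)"
        define w where "w = lincomb a ?B"
        have w: "w \<in> mat_kernel A" unfolding w_def using sub by (intro Ker.lincomb_closed) auto
        note vD = mat_kernelD[OF A v] and wD = mat_kernelD[OF A w]
        have "v - w \<in> mat_kernel A"
          using vD wD A by (intro mat_kernelI[OF A]) (auto simp: mult_minus_distrib_mat_vec[OF A])
        then have "v - w = 0\<^sub>v nc"
        proof (rule zero)
          fix i assume "i \<in> I"
          moreover from this I have "i < nc" by auto
          moreover from \<open>i \<in> I\<close> have "w $ i = v $ i"
            unfolding w_def by (simp add: lincomb_nth a_def the_inv_into_f_f[OF inj])
          ultimately show "(v - w) $ i = 0" using vD wD by simp
        qed
        then have "(v - w) $ i = 0" if "i < nc" for i using that by simp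
        then have "v = w" using vD(1) wD(1) by (intro eq_vecI) auto
        then show "v \<in> span ?B" unfolding w_def Ker.span_def using finB by auto
      qed
    qed
  qed
  then show ?thesis
    using Ker.dim_basis[OF finB] card_image[OF inj] by simp
qed

text \<open>Orders add over nonzero products, and a linear factor contributes 1 exactly when its
  root is \<open>e\<close>. For a triangular matrix this turns algebraic multiplicity into a count
  of diagonal entries.\<close>

lemma order_prod_list_linear:
  "Polynomial.order e (\<Prod>a\<leftarrow>as. [:- a, 1:]) = count_list as (e :: 'a :: idom)"
proof (induction as)
  case (Cons a as)
  have "Polynomial.order e [:- a, 1:] = (if a = e then 1 else 0)"
    using order_power_n_n[of e 1] by (auto intro: order_0I)
  moreover have "[:- a, 1:] * (\<Prod>a\<leftarrow>as. [:- a, 1:]) \<noteq> 0"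
    by (auto simp: prod_list_zero_iff simp del: mult_pCons_left)
  ultimately show ?case using Cons by (simp add: order_mult del: mult_pCons_left)
qed (simp add: order_0I)

text \<open>Similarity preserves the characteristic polynomial and the kernel dimension of
  \<open>char_matrix\<close>. For the diagonal matrix \<open>D\<close> both multiplicities count the
  diagonal entries equal to \<open>ev\<close>.\<close>

lemma real_diagonalizable_alg_mult_eq_geom_mult:
  assumes M: "M \<in> carrier_mat n n" and diag: "real_diagonalizable M"
  shows "alg_mult M ev = geom_mult M ev"
proof -
  from diag obtain D P Q where D: "diagonal_mat D" and wit: "similar_mat_wit M D P Q"
    unfolding real_diagonalizable_def similar_mat_def by auto
  have Dc: "D \<in> carrier_mat n n" using similar_mat_witD2[OF M wit] by simp
  have D0: "D $$ (i, j) = 0" if "i < n" "j < n" "i \<noteq> j" for i j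
    using D Dc that by (auto simp: diagonal_mat_def)
  have ut: "upper_triangular D" using D0 Dc by (auto simp: upper_triangular_def)
  define I where "I = {i. i < n \<and> D $$ (i, i) = ev}"
  have "alg_mult M ev = Polynomial.order ev (char_poly D)"
    unfolding alg_mult_def using char_poly_similar wit similar_mat_def by metis
  also have "\<dots> = count_list (diag_mat D) ev"
    unfolding char_poly_upper_triangular[OF Dc ut] order_prod_list_linear ..
  also have "\<dots> = card I"
    using Dc by (auto simp: count_list_eq_length_filter diag_mat_def I_def length_filter_map o_def
        length_filter_conv_card intro: arg_cong[of _ _ card])
  finally have alg: "alg_mult M ev = card I" .
  let ?C = "char_matrix D ev"
  have C: "?C \<in> carrier_mat n n" using Dc by simp
  have mult: "(?C *\<^sub>v v) $ i = (D $$ (i, i) - ev) * v $ i" if "i < n" "v \<in> carrier_vec n" for v i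
  proof -
    have "(?C *\<^sub>v v) $ i = (\<Sum>j\<in>{0..<n}. ?C $$ (i, j) * v $ j)"
      using that carrier_matD[OF C] by (auto simp: scalar_prod_def)
    also have "\<dots> = (\<Sum>j\<in>{0..<n}. if j = i then (D $$ (i, i) - ev) * v $ i else 0)"
      by (rule sum.cong) (use Dc D0 that in \<open>auto simp: char_matrix_def\<close>)
    finally show ?thesis using that by simp
  qed
  have ker: "v \<in> mat_kernel ?C \<longleftrightarrow> v \<in> carrier_vec n \<and> (\<forall>i<n. D $$ (i, i) = ev \<or> v $ i = 0)" for v
    unfolding mat_kernel[OF C] using carrier_matD[OF C]
    by (auto simp: mult vec_eq_iff simp del: index_mult_mat_vec)
  have "kernel_dim ?C = card I"
    \<comment> \<open>The unit vectors with index in \<open>I\<close> form the basis: by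
      \<open>ker\<close>, all other coordinates of a kernel vector vanish.\<close>
    by (rule kernel_dim_eq_card[OF C, where b = "unit_vec n"]) (auto simp: I_def ker vec_eq_iff)
  moreover have "kernel_dim (char_matrix M ev) = kernel_dim ?C"
    using similar_mat_wit_kernel_dim[OF char_matrix_closed[OF M] similar_mat_wit_char_matrix[OF wit]]
      carrier_matD[OF C] carrier_matD[OF char_matrix_closed[OF M]]
    by (simp add: kernel_dim_def)
  ultimately show ?thesis using alg by (simp add: geom_mult_def)
qed

section \<open>Block matrices\<close>

lemma diag_block_mat_replicate:
  assumes B: "B \<in> carrier_mat m m"
  shows "diag_block_mat (replicate N B) = mat (N * m) (N * m)
    (\<lambda>(i, j). if i div m = j div m then B $$ (i mod m, j mod m) else 0)"
proof (induction N)
  case 0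
  then show ?case by (intro eq_matI) auto
next
  case (Suc N)
  show ?case
  proof (cases "m = 0")
    case True
    then show ?thesis using Suc B by (intro eq_matI) auto
  next
    case False
    \<comment> \<open>Removing the first block lowers the block number of every later index by one
      and keeps its position within the block.\<close>
    then show ?thesis
      unfolding replicate_Suc diag_block_mat.simps Suc Let_def using B
      by (intro eq_matI) (auto simp: le_div_geq le_mod_geq)
  qed
qed

text \<open>Subtracting the matrix from \<open>X\<close> times the identity keeps the zero block, so
  the determinant over the polynomial ring factors.\<close>

lemma char_poly_four_block_zero_upper_right:
  fixes A1 :: "'a :: idom mat"
  assumes A1: "A1 \<in> carrier_mat n n" and A3: "A3 \<in> carrier_mat m n" and A4: "A4 \<in> carrier_mat m m"
  shows "char_poly (four_block_mat A1 (0\<^sub>m n m) A3 A4) = char_poly A1 * char_poly A4"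
proof -
  have "char_poly_matrix (four_block_mat A1 (0\<^sub>m n m) A3 A4) =
    four_block_mat (char_poly_matrix A1) (0\<^sub>m n m) (map_mat (\<lambda>a. [:- a:]) A3) (char_poly_matrix A4)"
    using assms by (intro eq_matI) (auto simp: char_poly_matrix_def one_poly_def)
  then show ?thesis
    unfolding char_poly_def using assms
    by (simp add: det_four_block_mat_upper_right_zero[where n = n and m = m])
qed

lemma det_2_by_2:
  fixes A :: "'a :: comm_ring_1 mat"
  assumes A: "A \<in> carrier_mat 2 2"
  shows "det A = A $$ (0, 0) * A $$ (1, 1) - A $$ (0, 1) * A $$ (1, 0)"
proof -
  have "det A = (\<Sum>j<2. A $$ (0, j) * cofactor A 0 j)"
    by (rule laplace_expansion_row[OF A]) simp
  also have "\<dots> = A $$ (0, 0) * A $$ (1, 1) - A $$ (0, 1) * A $$ (1, 0)"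
    using A by (simp add: numeral_2_eq_2 cofactor_def det_single mat_delete_def)
  finally show ?thesis .
qed

section \<open>Multiplicities for the shifted matrix\<close>

text \<open>This is \<open>A_L - u_m I\<close> at a state with all \<open>alpha_j = 0\<close>, where \<open>c\<close> stands for \<open>G h\<close> and
  \<open>b j\<close> for \<open>beta_j\<close>. In an \<open>alpha_j\<close>-column the index is \<open>2 j + 1\<close>, so it is itself the
  denominator \<open>2 j + 1\<close>.\<close>

definition shifted_matrix :: "nat \<Rightarrow> real \<Rightarrow> real \<Rightarrow> real \<Rightarrow> (nat \<Rightarrow> real) \<Rightarrow> real mat" where
  "shifted_matrix N c u v b = mat (2 * N + 3) (2 * N + 3) (\<lambda>(i, j).
     if j = 0 then
       if i = 0 then - u else if i = 1 then c - u\<^sup>2 else if i = 2 then - u * v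
       else if odd i then 0 else - u * b ((i - 1) div 2)
     else if j = 1 then
       if i = 0 then 1 else if i = 1 then u else if i = 2 then v
       else if odd i then 0 else b ((i - 1) div 2)
     else if i = 2 \<and> odd j then b ((j - 1) div 2) / real j else 0)"

lemma shifted_matrix_carrier [simp]:
  "shifted_matrix N c u v b \<in> carrier_mat (2 * N + 3) (2 * N + 3)"
  by (simp add: shifted_matrix_def)

lemma alg_mult_shifted_matrix:
  assumes "c \<noteq> 0"
  shows "alg_mult (u \<cdot>\<^sub>m 1\<^sub>m (2 * N + 3) + shifted_matrix N c u v b) u = 2 * N + 1"
proof -
  let ?m = "2 * N + 1"
  define M where "M = u \<cdot>\<^sub>m 1\<^sub>m (2 * N + 3) + shifted_matrix N c u v b"
  define T where "T = mat 2 2 (\<lambda>(i, j). M $$ (i, j))"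
  define C where "C = mat ?m 2 (\<lambda>(i, j). M $$ (i + 2, j))"
  define D where "D = mat ?m ?m (\<lambda>(i, j). M $$ (i + 2, j + 2))"
  have carr: "T \<in> carrier_mat 2 2" "C \<in> carrier_mat ?m 2" "D \<in> carrier_mat ?m ?m"
    by (auto simp: T_def C_def D_def)
  have dim: "dim_row M = 2 + ?m" "dim_col M = 2 + ?m" by (auto simp: M_def shifted_matrix_def)
  have M_nth: "M $$ (i, j) = (if i = j then u else 0) + shifted_matrix N c u v b $$ (i, j)"
    if "i < 2 * N + 3" "j < 2 * N + 3" for i j
    using that by (simp add: M_def carrier_matD[OF shifted_matrix_carrier])
  have zero: "M $$ (i, j) = 0" if "i < 2" "2 \<le> j" "j < 2 + ?m" for i j
    using that by (simp add: M_nth) (simp add: shifted_matrix_def)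
  have blocks: "M = four_block_mat T (0\<^sub>m 2 ?m) C D"
  proof (rule eq_matI)
    fix i j assume "i < dim_row (four_block_mat T (0\<^sub>m 2 ?m) C D)"
      "j < dim_col (four_block_mat T (0\<^sub>m 2 ?m) C D)"
    then have ij: "i < 2 + ?m" "j < 2 + ?m" using carr by auto
    \<comment> \<open>The lower blocks are defined with an offset of 2; this recovers the original
      index.\<close>
    have "Suc (Suc (k - 2)) = k" if "\<not> k < 2" for k :: nat using that by simp
    with ij show "M $$ (i, j) = four_block_mat T (0\<^sub>m 2 ?m) C D $$ (i, j)"
      using zero[of i j] by (cases "i < 2"; cases "j < 2") (auto simp: T_def C_def D_def)
  qed (use carr dim in auto)
  \<comment> \<open>Off its diagonal, \<open>D\<close> has nonzero entries at most in its first row,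
    the \<open>h v_m\<close>-row of \<open>M\<close>.\<close>
  have ut: "upper_triangular D"
    by (auto simp: upper_triangular_def D_def M_nth) (auto simp: shifted_matrix_def)
  have "diag_mat D = replicate ?m u"
    by (intro nth_equalityI) (auto simp: diag_mat_def D_def M_nth shifted_matrix_def simp del: replicate_Suc upt_Suc)
  then have D: "Polynomial.order u (char_poly D) = ?m"
    by (simp only: char_poly_upper_triangular[OF carr(3) ut] order_prod_list_linear
        count_list_eq_length_filter filter_replicate) simp
  \<comment> \<open>\<open>T\<close> has the rows \<open>(0, 1)\<close> and
    \<open>(c - u^2, 2 u)\<close>, so its characteristic polynomial is
    \<open>(X - u)^2 - c\<close>.\<close>
  have "poly (char_poly T) u = - c"
    by (simp add: char_poly_def det_2_by_2[of "char_poly_matrix T"] carr)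
       (simp add: char_poly_matrix_def T_def M_nth shifted_matrix_def algebra_simps power2_eq_square)
  then have T: "Polynomial.order u (char_poly T) = 0" "char_poly T \<noteq> 0"
    using assms by (auto intro!: order_0I)
  have "char_poly D \<noteq> 0" using degree_monic_char_poly[OF carr(3)] by auto
  then show ?thesis
    unfolding alg_mult_def M_def[symmetric] blocks char_poly_four_block_zero_upper_right[OF carr]
    using T D by (simp add: order_mult)
qed

text \<open>Once the first two coordinates are zero, only row 2 still imposes a condition. It can be
  solved for the \<open>alpha_k\<close>-coordinate because \<open>b k\<close> is nonzero, which
  leaves \<open>2 * N\<close> free coordinates.\<close>

lemma kernel_dim_shifted_matrix:
  assumes c: "c \<noteq> 0" and k: "k \<in> {1..N}" "b k \<noteq> 0"
  shows "kernel_dim (shifted_matrix N c u v b) = 2 * N"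
proof -
  let ?n = "2 * N + 3"
  let ?E = "shifted_matrix N c u v b"
  define r where "r j = (if odd j then b ((j - 1) div 2) / real j else 0)" for j
  \<comment> \<open>The pivot: the \<open>alpha_k\<close>-column, where the coefficient of the row 2
    equation is nonzero.\<close>
  let ?p = "2 * k + 1"
  have p: "?p \<in> {2..<?n}" "r ?p \<noteq> 0" using k by (auto simp: r_def)
  have mult: "(?E *\<^sub>v x) $ i = ?E $$ (i, 0) * x $ 0 + ?E $$ (i, 1) * x $ 1 +
      (if i = 2 then \<Sum>j\<in>{2..<?n}. r j * x $ j else 0)" if "i < ?n" "x \<in> carrier_vec ?n" for x i
  proof -
    have "(?E *\<^sub>v x) $ i = (\<Sum>j\<in>{0..<?n}. ?E $$ (i, j) * x $ j)"
      using that carrier_matD[OF shifted_matrix_carrier] by (auto simp: scalar_prod_def)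
    also have "{0..<?n} = insert 0 (insert 1 {2..<?n})" by auto
    also have "(\<Sum>j\<in>\<dots>. ?E $$ (i, j) * x $ j) = ?E $$ (i, 0) * x $ 0 + ?E $$ (i, 1) * x $ 1 +
        (\<Sum>j\<in>{2..<?n}. ?E $$ (i, j) * x $ j)" by simp
    also have "(\<Sum>j\<in>{2..<?n}. ?E $$ (i, j) * x $ j) = (\<Sum>j\<in>{2..<?n}. if i = 2 then r j * x $ j else 0)"
      by (rule sum.cong) (use that in \<open>auto simp: shifted_matrix_def r_def\<close>)
    finally show ?thesis by simp
  qed
  have ker: "x \<in> mat_kernel ?E \<longleftrightarrow> x \<in> carrier_vec ?n \<and> x $ 0 = 0 \<and> x $ 1 = 0 \<and>
      (\<Sum>j\<in>{2..<?n}. r j * x $ j) = 0" (is "_ \<longleftrightarrow> ?R x") for x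
  proof
    assume "x \<in> mat_kernel ?E"
    from mat_kernelD[OF shifted_matrix_carrier this]
    have x: "x \<in> carrier_vec ?n" and "?E *\<^sub>v x = 0\<^sub>v ?n" by auto
    then have eq: "(?E *\<^sub>v x) $ i = 0" if "i < ?n" for i using that by simp
    \<comment> \<open>Rows 0 and 1 form a system in the first two coordinates with determinant
      \<open>- c\<close>, so both coordinates vanish.\<close>
    have "- u * x $ 0 + x $ 1 = 0"
      using eq[of 0] mult[of 0, OF _ x] by (simp add: shifted_matrix_def)
    then have x1: "x $ 1 = u * x $ 0" by simp
    have "(c - u\<^sup>2) * x $ 0 + u * x $ 1 = 0"
      using eq[of 1] mult[of 1, OF _ x] by (simp add: shifted_matrix_def)
    then have "c * x $ 0 = 0" unfolding x1 by (simp add: algebra_simps power2_eq_square)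
    then have x0: "x $ 0 = 0" using c by simp
    then show "?R x" using x x1 eq[of 2] mult[of 2, OF _ x] by simp
  next
    assume "?R x"
    then show "x \<in> mat_kernel ?E"
      by (intro mat_kernelI[OF shifted_matrix_carrier] eq_vecI)
         (auto simp: mult carrier_matD[OF shifted_matrix_carrier] simp del: index_mult_mat_vec)
  qed
  define I where "I = {2..<?n} - {?p}"
  have I: "{2..<?n} = insert ?p I" "?p \<notin> I" "finite I" using p by (auto simp: I_def)
  \<comment> \<open>The basis vector for the free index \<open>i\<close>; its pivot entry is what
    the row 2 equation dictates.\<close>
  define e where "e i = vec ?n (\<lambda>j. if j = i then 1 else if j = ?p then - r i / r ?p else 0)" for i
  have "kernel_dim ?E = card I"
  proof (rule kernel_dim_eq_card[OF shifted_matrix_carrier, where b = e])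
    show "I \<subseteq> {..<?n}" by (auto simp: I_def)
    show "e i \<in> mat_kernel ?E" if i: "i \<in> I" for i
    proof -
      have "(\<Sum>j\<in>I. r j * e i $ j) = (\<Sum>j\<in>I. if j = i then r i else 0)"
        by (rule sum.cong) (auto simp: e_def I_def)
      moreover have "(\<Sum>j\<in>I. if j = i then r i else 0) = r i" using I i by simp
      moreover have "e i $ ?p = - r i / r ?p" using i p by (auto simp: e_def I_def)
      ultimately have "(\<Sum>j\<in>{2..<?n}. r j * e i $ j) = 0"
        using I p \<open>e i $ ?p = _\<close> by simp
      then show ?thesis using i k by (auto simp: ker e_def I_def)
    qed
    show "e i $ j = (if i = j then 1 else 0)" if "i \<in> I" "j \<in> I" for i j
      using that by (auto simp: e_def I_def)
    fix x assume x: "x \<in> mat_kernel ?E" and x0: "\<And>i. i \<in> I \<Longrightarrow> x $ i = 0"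
    have "(\<Sum>j\<in>I. r j * x $ j) = 0" using x0 by simp
    then have "x $ ?p = 0" using x p I by (simp add: ker)
    then have "x $ i = 0" if "i < ?n" for i
      using x x0[of i] that by (cases "i = 0 \<or> i = 1 \<or> i = ?p") (auto simp: ker I_def)
    then show "x = 0\<^sub>v ?n" using x by (auto simp: ker)
  qed
  also have "card I = 2 * N" using p by (simp add: I_def)
  finally show ?thesis .
qed

section \<open>Entries of the coefficient matrix where all \<open>alpha_j\<close> vanish\<close>

lemma swlme_A_carrier [simp]: "swlme_A N G U \<in> carrier_mat (2 * N + 3) (2 * N + 3)"
  and swlme_B_carrier [simp]: "swlme_B N G U \<in> carrier_mat (2 * N + 3) (2 * N + 3)"
  by (auto simp: swlme_A_def swlme_B_def nonconservative_x_def nonconservative_y_def jacobian_def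
      dim_diag_block_mat sum_list_replicate mat_of_rows_list_def)

lemma nonconservative_x_carrier:
  "nonconservative_x N U \<in> carrier_mat (2 * N + 3) (2 * N + 3)"
  by (auto simp: nonconservative_x_def dim_diag_block_mat sum_list_replicate mat_of_rows_list_def)

text \<open>Only the first column of each block is nonzero. The offset 3 flips parity, so these are
  the odd columns from 3 on, with entries on the diagonal and just below it.\<close>

lemma nonconservative_x_nth:
  assumes i: "i < 2 * N + 3" and j: "j < 2 * N + 3"
  shows "nonconservative_x N U $$ (i, j) =
    (if i \<ge> 3 \<and> odd j \<and> j = i then - um U else if odd j \<and> j \<ge> 3 \<and> i = j + 1 then - vm U else 0)"
proof -
  define P where "P = mat_of_rows_list 2 [[- um U, 0], [- vm U, 0]]"
  have P: "P \<in> carrier_mat 2 2" and P_nth: "P $$ (0, 0) = - um U" "P $$ (0, 1) = 0"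
    "P $$ (1, 0) = - vm U" "P $$ (1, 1) = 0"
    by (auto simp: P_def mat_of_rows_list_def)
  \<comment> \<open>For even \<open>l\<close>, the indices \<open>l\<close> and \<open>l + 1\<close>
    make up one block, so the block structure reduces to a parity test.\<close>
  have block: "(if k div 2 = l div 2 then P $$ (k mod 2, l mod 2) else 0) =
      (if even l \<and> l = k then - um U else if even l \<and> k = l + 1 then - vm U else 0)" for k l :: nat
  proof (cases "k div 2 = l div 2")
    case True
    then have "l = k \<longleftrightarrow> k mod 2 = l mod 2" "k = l + 1 \<longleftrightarrow> k mod 2 = 1 \<and> l mod 2 = 0"
      by presburger+
    then show ?thesis using True P_nth
      by (cases "k mod 2 = 0"; cases "l mod 2 = 0") auto
  next
    case False
    then show ?thesis by (auto elim!: evenE)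
  qed
  define Q where "Q = mat (N * 2) (N * 2)
    (\<lambda>(k, l). if k div 2 = l div 2 then P $$ (k mod 2, l mod 2) else 0)"
  have Q: "dim_row Q = 2 * N" "dim_col Q = 2 * N" by (auto simp: Q_def)
  have Q_nth: "Q $$ (k, l) = (if k div 2 = l div 2 then P $$ (k mod 2, l mod 2) else 0)"
    if "k < 2 * N" "l < 2 * N" for k l using that by (simp add: Q_def)
  have "nonconservative_x N U $$ (i, j) = (if i < 3 \<or> j < 3 then 0 else
      if (i - 3) div 2 = (j - 3) div 2 then P $$ ((i - 3) mod 2, (j - 3) mod 2) else 0)"
    unfolding nonconservative_x_def P_def[symmetric] diag_block_mat.simps Let_def
      diag_block_mat_replicate[OF P] Q_def[symmetric] using i j
    by (cases "i < 3"; cases "j < 3") (simp_all add: Q Q_nth)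
  also have "\<dots> = (if i < 3 \<or> j < 3 then 0 else
      if even (j - 3) \<and> j - 3 = i - 3 then - um U
      else if even (j - 3) \<and> i - 3 = j - 3 + 1 then - vm U else 0)"
    unfolding block ..
  also have "\<dots> = (if i \<ge> 3 \<and> odd j \<and> j = i then - um U
      else if odd j \<and> j \<ge> 3 \<and> i = j + 1 then - vm U else 0)"
  proof (cases "i < 3 \<or> j < 3")
    case False
    then have "even (j - 3) \<longleftrightarrow> odd j" "j - 3 = i - 3 \<longleftrightarrow> j = i" "i - 3 = j - 3 + 1 \<longleftrightarrow> i = j + 1"
      by auto
    then show ?thesis using False by auto
  qed auto
  finally show ?thesis .
qed

lemma update_vec_has_derivative:
  assumes "j < dim_vec U"
  shows "((\<lambda>t. update_vec U j t $ k) has_real_derivative of_bool (k = j)) (at x)"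
  using assms by (cases "k = j") auto

text \<open>The nonconservative part is subtracted here so that it cancels in
  \<open>swlme_A\<close>. Since every \<open>alpha_k\<close> vanishes at \<open>U\<close>, a product
  containing \<open>alpha_k\<close> contributes only through the derivative of that factor, and the
  squares contribute nothing.\<close>

lemma flux_x_has_derivative:
  assumes U: "U \<in> state_space N" and al: "\<forall>k\<in>{1..N}. alpha k U = 0"
    and i: "i < 2 * N + 3" and j: "j < 2 * N + 3"
  shows "((\<lambda>t. flux_x N G (update_vec U j t) $ i) has_real_derivative
    (um U \<cdot>\<^sub>m 1\<^sub>m (2 * N + 3) + shifted_matrix N (G * water_height U) (um U) (vm U) (\<lambda>k. beta k U)
      - nonconservative_x N U) $$ (i, j)) (at (U $ j))" (is "(_ has_real_derivative ?D) _")
proof -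
  define h u v where "h = water_height U" and "u = um U" and "v = vm U"
  define V where "V = update_vec U j"
  \<comment> \<open>\<open>d k\<close> is the derivative of component \<open>k\<close> along
    coordinate \<open>j\<close>. As an indicator, it lets one formula per row cover all
    columns.\<close>
  define d where "d k = (of_bool (k = j) :: real)" for k
  have h: "h > 0" and dim: "dim_vec U = 2 * N + 3" using U by (auto simp: state_space_def h_def)
  have V0 [simp]: "V (U $ j) = U" by (auto simp: V_def update_vec_def)
  have V: "((\<lambda>t. V t $ k) has_real_derivative d k) (at (U $ j))" for k
    unfolding V_def d_def using j dim by (intro update_vec_has_derivative) simp
  have H: "((\<lambda>t. water_height (V t)) has_real_derivative d 0) (at (U $ j))"
    unfolding water_height_def by (rule V)
  have quotient: "((\<lambda>t. V t $ k / water_height (V t)) has_real_derivative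
      (d k - U $ k / h * d 0) / h) (at (U $ j))" for k
    using h by (auto intro!: derivative_eq_intros V H simp: h_def[symmetric] field_simps)
  have um: "((\<lambda>t. um (V t)) has_real_derivative (d 1 - u * d 0) / h) (at (U $ j))"
    using quotient[of 1] by (simp add: um_def u_def h_def)
  have vm: "((\<lambda>t. vm (V t)) has_real_derivative (d 2 - v * d 0) / h) (at (U $ j))"
    using quotient[of 2] by (simp add: vm_def v_def h_def)
  \<comment> \<open>The term of the quotient rule from varying \<open>h\<close> drops out because
    \<open>alpha k U = 0\<close>.\<close>
  have alpha: "((\<lambda>t. alpha k (V t)) has_real_derivative d (2 * k + 1) / h) (at (U $ j))"
    if "k \<in> {1..N}" for k
    using quotient[of "2 * k + 1"] bspec[OF al that] h by (auto simp: alpha_def h_def)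
  have beta: "((\<lambda>t. beta k (V t)) has_real_derivative (d (2 * k + 2) - beta k U * d 0) / h)
      (at (U $ j))" for k
    using quotient[of "2 * k + 2"] by (simp add: beta_def h_def)
  have sum1: "((\<lambda>t. \<Sum>k = 1..N. (alpha k (V t))\<^sup>2 / real (2 * k + 1)) has_real_derivative 0)
      (at (U $ j))"
  proof -
    have "((\<lambda>t. (alpha k (V t))\<^sup>2 / real (2 * k + 1)) has_real_derivative 0) (at (U $ j))"
      if "k \<in> {1..N}" for k
      using bspec[OF al that] by (auto intro!: derivative_eq_intros alpha[OF that])
    then have "((\<lambda>t. \<Sum>k = 1..N. (alpha k (V t))\<^sup>2 / real (2 * k + 1)) has_real_derivative
      (\<Sum>k = 1..N. 0)) (at (U $ j))" by (rule DERIV_sum)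
    then show ?thesis by simp
  qed
  \<comment> \<open>At most the summand with \<open>2 * k + 1 = j\<close> survives, so
    \<open>j\<close> is its denominator. The guard \<open>j \<ge> 3\<close> excludes
    \<open>j = 1\<close>, the odd index of \<open>h u_m\<close>.\<close>
  define r where "r = (if odd j \<and> j \<ge> 3 then beta ((j - 1) div 2) U / real j else 0)"
  have sum2: "((\<lambda>t. \<Sum>k = 1..N. alpha k (V t) * beta k (V t) / real (2 * k + 1)) has_real_derivative
      r / h) (at (U $ j))"
  proof -
    have "((\<lambda>t. alpha k (V t) * beta k (V t) / real (2 * k + 1)) has_real_derivative
        d (2 * k + 1) / h * beta k U / real (2 * k + 1)) (at (U $ j))"
      if "k \<in> {1..N}" for k
      by (rule DERIV_cdivide, rule DERIV_cong[OF DERIV_mult[OF alpha[OF that] beta]])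
        (use bspec[OF al that] in simp)
    then have "((\<lambda>t. \<Sum>k = 1..N. alpha k (V t) * beta k (V t) / real (2 * k + 1)) has_real_derivative
      (\<Sum>k = 1..N. d (2 * k + 1) / h * beta k U / real (2 * k + 1))) (at (U $ j))" by (rule DERIV_sum)
    also have "(\<Sum>k = 1..N. d (2 * k + 1) / h * beta k U / real (2 * k + 1)) =
        (\<Sum>k = 1..N. if k = (j - 1) div 2 then r / h else 0)"
      by (rule sum.cong) (auto simp: d_def r_def elim!: oddE)
    also have "\<dots> = r / h" using j by (auto simp: r_def elim!: oddE)
    finally show ?thesis .
  qed
  have al0: "(\<Sum>k = 1..N. (alpha k U)\<^sup>2 / real (2 * k + 1)) = 0"
    "(\<Sum>k = 1..N. alpha k U * beta k U / real (2 * k + 1)) = 0" using al by auto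
  have D: "?D = (if i = j then u else 0) + shifted_matrix N (G * h) u v (\<lambda>k. beta k U) $$ (i, j)
      - (if i \<ge> 3 \<and> odd j \<and> j = i then - u else if odd j \<and> j \<ge> 3 \<and> i = j + 1 then - v else 0)"
    using i j by (simp add: nonconservative_x_nth carrier_matD[OF shifted_matrix_carrier]
        carrier_matD[OF nonconservative_x_carrier] h_def u_def v_def)
  note D_simps = shifted_matrix_def i j
  note derivs = derivative_eq_intros H um vm
  have "((\<lambda>t. flux_x N G (V t) $ i) has_real_derivative ?D) (at (U $ j))"
  proof -
    consider "i = 0" | "i = 1" | "i = 2" | k where "k \<in> {1..N}" "i = 2 * k + 1"
      | k where "k \<in> {1..N}" "i = 2 * k + 2"
    proof (cases "i < 3")
      case True
      then show ?thesis using that(1-3) by linarith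
    next
      case False
      show ?thesis
      proof (cases "odd i")
        case True
        with False i show ?thesis by (intro that(4)[of "(i - 1) div 2"]) auto
      next
        case even: False
        then obtain l where "i = 2 * l" by (auto elim: evenE)
        with False i show ?thesis by (intro that(5)[of "l - 1"]) auto
      qed
    qed
    then show ?thesis
    proof cases
      case 1
      have "((\<lambda>t. water_height (V t) * um (V t)) has_real_derivative d 1) (at (U $ j))"
        using h by (auto intro!: derivs simp: h_def[symmetric] u_def[symmetric] field_simps)
      moreover have "d 1 = ?D" unfolding D using 1 by (simp add: D_simps d_def)
      ultimately show ?thesis using 1 by (simp add: flux_x_def Let_def)
    next
      case 2
      have "((\<lambda>t. water_height (V t) *
            ((um (V t))\<^sup>2 + (\<Sum>k = 1..N. (alpha k (V t))\<^sup>2 / real (2 * k + 1)))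
          + 1 / 2 * G * (water_height (V t))\<^sup>2) has_real_derivative
          (G * h - u\<^sup>2) * d 0 + 2 * u * d 1) (at (U $ j))"
        by (rule derivs sum1 refl)+
          (use h al0 in \<open>simp add: h_def[symmetric] u_def[symmetric] field_simps power2_eq_square\<close>)
      moreover have "(G * h - u\<^sup>2) * d 0 + 2 * u * d 1 = ?D"
        unfolding D using 2 by (simp add: D_simps d_def)
      ultimately show ?thesis using 2 by (simp add: flux_x_def Let_def)
    next
      case 3
      have "((\<lambda>t. water_height (V t) * (um (V t) * vm (V t) +
          (\<Sum>k = 1..N. alpha k (V t) * beta k (V t) / real (2 * k + 1)))) has_real_derivative
          - u * v * d 0 + v * d 1 + u * d 2 + r) (at (U $ j))"
        by (rule derivs sum2 refl)+
          (use h al0 in \<open>simp add: h_def[symmetric] u_def[symmetric] v_def[symmetric] field_simps\<close>)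
      moreover have "- u * v * d 0 + v * d 1 + u * d 2 + r = ?D"
        unfolding D using 3 by (auto simp: D_simps d_def r_def)
      ultimately show ?thesis using 3 by (simp add: flux_x_def Let_def)
    next
      case (4 k)
      have "((\<lambda>t. 2 * water_height (V t) * um (V t) * alpha k (V t)) has_real_derivative
          2 * u * d (2 * k + 1)) (at (U $ j))"
        using h bspec[OF al 4(1)] by (auto intro!: derivs alpha[OF 4(1)] simp: h_def[symmetric] u_def[symmetric])
      \<comment> \<open>Of the diagonal entry \<open>2 * u\<close>, one \<open>u\<close> comes from
        the identity and one from the subtracted \<open>- u\<close>.\<close>
      moreover have "2 * u * d (2 * k + 1) = ?D" unfolding D using 4 by (auto simp: D_simps d_def)
      ultimately show ?thesis using 4 i by (simp add: flux_x_def Let_def)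
    next
      case (5 k)
      have "((\<lambda>t. water_height (V t) * (um (V t) * beta k (V t) + vm (V t) * alpha k (V t)))
          has_real_derivative - u * beta k U * d 0 + beta k U * d 1 + v * d (2 * k + 1) + u * d (2 * k + 2))
          (at (U $ j))"
        by (rule derivs alpha[OF 5(1)] beta refl)+
          (use h bspec[OF al 5(1)] in \<open>simp add: h_def[symmetric] u_def[symmetric] v_def[symmetric] field_simps\<close>)
      \<comment> \<open>The first two terms are the shifted matrix entries, the \<open>v\<close>
        term is the subtracted \<open>- v\<close>, and the last is the identity.\<close>
      moreover have "- u * beta k U * d 0 + beta k U * d 1 + v * d (2 * k + 1) + u * d (2 * k + 2) = ?D"
        unfolding D using 5 by (auto simp: D_simps d_def)
      ultimately show ?thesis using 5 i by (simp add: flux_x_def Let_def)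
    qed
  qed
  then show ?thesis unfolding V_def .
qed

lemma swlme_A_alpha_zero:
  assumes U: "U \<in> state_space N" and al: "\<forall>k\<in>{1..N}. alpha k U = 0"
  shows "swlme_A N G U = um U \<cdot>\<^sub>m 1\<^sub>m (2 * N + 3) +
    shifted_matrix N (G * water_height U) (um U) (vm U) (\<lambda>k. beta k U)" (is "_ = ?M")
proof (rule eq_matI)
  fix i j assume "i < dim_row ?M" "j < dim_col ?M"
  then have ij: "i < 2 * N + 3" "j < 2 * N + 3"
    using carrier_matD[OF shifted_matrix_carrier] by auto
  show "swlme_A N G U $$ (i, j) = ?M $$ (i, j)"
    using ij DERIV_imp_deriv[OF flux_x_has_derivative[OF U al ij]]
    by (simp add: swlme_A_def jacobian_def carrier_matD[OF nonconservative_x_carrier])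
qed (use carrier_matD[OF swlme_A_carrier] carrier_matD[OF shifted_matrix_carrier] in auto)

section \<open>Multiplicities of \<open>u_m\<close> and failure of hyperbolicity\<close>

lemma swlme_A_multiplicities:
  assumes "G > 0" and U: "U \<in> state_space N" and al: "\<forall>k\<in>{1..N}. alpha k U = 0"
    and k: "k \<in> {1..N}" "beta k U \<noteq> 0"
  shows "eigenvalue (swlme_A N G U) (um U)"
    and "alg_mult (swlme_A N G U) (um U) = 2 * N + 1"
    and "geom_mult (swlme_A N G U) (um U) = 2 * N"
proof -
  let ?E = "shifted_matrix N (G * water_height U) (um U) (vm U) (\<lambda>k. beta k U)"
  note A = swlme_A_alpha_zero[OF U al, of G]
  have c: "G * water_height U \<noteq> 0" using U \<open>G > 0\<close> by (auto simp: state_space_def)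
  show alg: "alg_mult (swlme_A N G U) (um U) = 2 * N + 1"
    unfolding A by (rule alg_mult_shifted_matrix[OF c])
  have "char_matrix (swlme_A N G U) (um U) = ?E"
    unfolding A char_matrix_def using carrier_matD[OF shifted_matrix_carrier]
    by (intro eq_matI) auto
  then show "geom_mult (swlme_A N G U) (um U) = 2 * N"
    unfolding geom_mult_def using kernel_dim_shifted_matrix[where b = "\<lambda>k. beta k U", OF c k] by simp
  show "eigenvalue (swlme_A N G U) (um U)"
    \<comment> \<open>A positive order of the characteristic polynomial at \<open>um U\<close> makes
      it a root.\<close>
    unfolding eigenvalue_root_char_poly[OF swlme_A_carrier] using alg order_0I
    by (metis alg_mult_def add_is_0 one_neq_zero)
qed

theorem theorem3p4:
  fixes N :: nat and G :: real
  assumes "N \<ge> 1" and "G > 0"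
  shows "(\<forall>U \<in> state_space N.
            (\<forall>j \<in> {1..N}. alpha j U = 0) \<and> (\<exists>j \<in> {1..N}. beta j U \<noteq> 0) \<longrightarrow>
              eigenvalue (swlme_A N G U) (um U) \<and>
              alg_mult (swlme_A N G U) (um U) = 2 * N + 1 \<and>
              geom_mult (swlme_A N G U) (um U) = 2 * N)
         \<and> \<not> globally_hyperbolic N (swlme_A N G) (swlme_B N G)"
proof (intro conjI ballI impI)
  fix U assume U: "U \<in> state_space N"
    and "(\<forall>j \<in> {1..N}. alpha j U = 0) \<and> (\<exists>j \<in> {1..N}. beta j U \<noteq> 0)"
  then obtain k where k: "k \<in> {1..N}" "beta k U \<noteq> 0" and al: "\<forall>k\<in>{1..N}. alpha k U = 0"
    by auto
  note mult = swlme_A_multiplicities[OF \<open>G > 0\<close> U al k]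
  show "eigenvalue (swlme_A N G U) (um U)" by (rule mult(1))
  show "alg_mult (swlme_A N G U) (um U) = 2 * N + 1" by (rule mult(2))
  show "geom_mult (swlme_A N G U) (um U) = 2 * N" by (rule mult(3))
next
  \<comment> \<open>\<open>h = 1\<close>, \<open>beta_1 = 1\<close>, everything else zero\<close>
  define U :: "real Matrix.vec" where "U = Matrix.vec (2 * N + 3) (\<lambda>i. if i = 0 \<or> i = 4 then 1 else 0)"
  have U: "U \<in> state_space N" by (simp add: U_def state_space_def water_height_def)
  have al: "\<forall>k\<in>{1..N}. alpha k U = 0"
    \<comment> \<open>The \<open>alpha_k\<close>-indices \<open>2 * k + 1\<close> are odd, so they
      miss 0 and 4.\<close>
    by (auto simp: U_def alpha_def) presburger
  have one: "1 \<in> {1..N}" "beta 1 U \<noteq> 0"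
    using \<open>N \<ge> 1\<close> by (auto simp: U_def beta_def water_height_def)
  note mult = swlme_A_multiplicities[OF \<open>G > 0\<close> U al one]
  show "\<not> globally_hyperbolic N (swlme_A N G) (swlme_B N G)"
  proof
    assume "globally_hyperbolic N (swlme_A N G) (swlme_B N G)"
    with U have "real_diagonalizable (cos 0 \<cdot>\<^sub>m swlme_A N G U + sin 0 \<cdot>\<^sub>m swlme_B N G U)"
      unfolding globally_hyperbolic_def by blast
    \<comment> \<open>The \<open>swlme_B\<close> term vanishes but still determines the dimensions
      of the sum, hence its carrier fact.\<close>
    also have "cos 0 \<cdot>\<^sub>m swlme_A N G U + sin 0 \<cdot>\<^sub>m swlme_B N G U = swlme_A N G U"
      using carrier_matD[OF swlme_A_carrier, of N G U] carrier_matD[OF swlme_B_carrier, of N G U]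
      by (intro eq_matI) auto
    finally have "real_diagonalizable (swlme_A N G U)" .
    from real_diagonalizable_alg_mult_eq_geom_mult[OF swlme_A_carrier this] mult
    show False by simp
  qed
qed

end
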